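(* Let $1\leq s\leq t$, let $G_1,\dots,G_s$ be connected graphs of chromatic number $3$, and let $G_{s+1},\dots,G_t$ be connected bipartite graphs. Suppose that for each $i\in\{1,\dots,t\}$, $G_i$ admits a proper $3$-vertex-coloring with color classes of sizes $a_i\geq b_i\geq c_i=\sigma_3(G_i)$ such that (i) $a_i-b_i\leq 1$ for each $i\in\{1,\dots,s\}$, and $a_i=b_i$ for each $i\in\{s+1,\dots,t\}$; and (ii) $b_i+c_i\geq \sum_{j\in\{1,\dots,t\}\setminus\{i\}} c_j$ for each $i\in\{1,\dots,t\}$. Then $f(G_1\cup\cdots\cup G_t,P_5)=R_3(G_1\cup\cdots\cup G_t)$.
   Context: For a $k$-chromatic graph $G$, the chromatic surplus $\sigma(G)$ is the minimum, over all proper $k$-vertex-colorings of $G$, of the minimum size of a color class. For a graph $G$ with $\chi(G)\leq 3$, $\sigma_3(G)=\sigma(G)$ if $\chi(G)=3$ and $\sigma_3(G)=0$ otherwise (so for bipartite $G_i$ one color class is empty). $\cup$ is vertex-disjoint union. $P_5$ is the path on $5$ vertices. Monochromatic: all edges same color; rainbow: all edges distinct colors. $f(H,G)$ is the minimum $n$ such that every edge-coloring of $K_n$ with any number of colors contains a monochromatic $H$ or a rainbow $G$. $R_3(H)$ is the minimum $n$ such that every coloring of $E(K_n)$ with colors from $\{1,2,3\}$ (not all need be used) contains a monochromatic $H$. *)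

theory Defs
  imports Main
begin

record 'a ugraph =
  verts :: "'a set"
  edges :: "'a set set"

definition simple_graph :: "'a ugraph \<Rightarrow> bool" where
  "simple_graph G \<longleftrightarrow> finite (verts G) \<and> (\<forall>e\<in>edges G. e \<subseteq> verts G \<and> card e = 2)"

definition connected_graph :: "'a ugraph \<Rightarrow> bool" where
  "connected_graph G \<longleftrightarrow> verts G \<noteq> {} \<and>
     (\<forall>u\<in>verts G. \<forall>v\<in>verts G. (u, v) \<in> {(x, y). {x, y} \<in> edges G}\<^sup>*)"

text \<open>Colour classes are allowed to be empty.\<close>

definition proper_coloring :: "'a ugraph \<Rightarrow> nat \<Rightarrow> ('a \<Rightarrow> nat) \<Rightarrow> bool" where
  "proper_coloring G k \<phi> \<longleftrightarrow> (\<forall>v\<in>verts G. \<phi> v < k) \<and>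
     (\<forall>u v. {u, v} \<in> edges G \<longrightarrow> \<phi> u \<noteq> \<phi> v)"

definition color_class :: "'a ugraph \<Rightarrow> ('a \<Rightarrow> nat) \<Rightarrow> nat \<Rightarrow> 'a set" where
  "color_class G \<phi> j = {v \<in> verts G. \<phi> v = j}"

definition chromatic_number :: "'a ugraph \<Rightarrow> nat" where
  "chromatic_number G = (LEAST k. \<exists>\<phi>. proper_coloring G k \<phi>)"

definition bipartite_graph :: "'a ugraph \<Rightarrow> bool" where
  "bipartite_graph G \<longleftrightarrow> (\<exists>\<phi>. proper_coloring G 2 \<phi>)"

definition chromatic_surplus :: "'a ugraph \<Rightarrow> nat" where
  "chromatic_surplus G =
     (LEAST m. \<exists>\<phi>. proper_coloring G (chromatic_number G) \<phi> \<and>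
        m = Min ((\<lambda>j. card (color_class G \<phi> j)) ` {..<chromatic_number G}))"

definition chromatic_surplus3 :: "'a ugraph \<Rightarrow> nat" where
  "chromatic_surplus3 G = (if chromatic_number G = 3 then chromatic_surplus G else 0)"

definition disjoint_union_graph :: "'i set \<Rightarrow> ('i \<Rightarrow> 'a ugraph) \<Rightarrow> ('i \<times> 'a) ugraph" where
  "disjoint_union_graph I G =
     \<lparr>verts = (SIGMA i:I. verts (G i)),
      edges = (\<Union>i\<in>I. (\<lambda>e. Pair i ` e) ` edges (G i))\<rparr>"

definition path_graph :: "nat \<Rightarrow> nat ugraph" where
  "path_graph n = \<lparr>verts = {..<n}, edges = {{i, Suc i} | i. Suc i < n}\<rparr>"

definition complete_graph :: "nat \<Rightarrow> nat ugraph" where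
  "complete_graph n = \<lparr>verts = {..<n}, edges = {e. e \<subseteq> {..<n} \<and> card e = 2}\<rparr>"

definition graph_embedding :: "('a \<Rightarrow> 'b) \<Rightarrow> 'a ugraph \<Rightarrow> 'b ugraph \<Rightarrow> bool" where
  "graph_embedding g H K \<longleftrightarrow> inj_on g (verts H) \<and> g ` verts H \<subseteq> verts K \<and>
     (\<forall>e\<in>edges H. g ` e \<in> edges K)"

text \<open>An edge-colouring of \<open>K\<close> is a function \<open>c\<close> on sets of vertices, of which only the values
  on \<open>edges K\<close> matter.\<close>

definition has_monochromatic :: "'a ugraph \<Rightarrow> 'b ugraph \<Rightarrow> ('b set \<Rightarrow> nat) \<Rightarrow> bool" where
  "has_monochromatic H K c \<longleftrightarrow>
     (\<exists>g. graph_embedding g H K \<and> (\<exists>k. \<forall>e\<in>edges H. c (g ` e) = k))"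

definition has_rainbow :: "'a ugraph \<Rightarrow> 'b ugraph \<Rightarrow> ('b set \<Rightarrow> nat) \<Rightarrow> bool" where
  "has_rainbow H K c \<longleftrightarrow>
     (\<exists>g. graph_embedding g H K \<and> inj_on (\<lambda>e. c (g ` e)) (edges H))"

definition constrained_ramsey :: "'a ugraph \<Rightarrow> 'b ugraph \<Rightarrow> nat" where
  "constrained_ramsey H G =
     (LEAST n. \<forall>c. has_monochromatic H (complete_graph n) c \<or> has_rainbow G (complete_graph n) c)"

definition ramsey3 :: "'a ugraph \<Rightarrow> nat" where
  "ramsey3 H =
     (LEAST n. \<forall>c. c ` edges (complete_graph n) \<subseteq> {1, 2, 3} \<longrightarrow>
        has_monochromatic H (complete_graph n) c)"

end

theory Submission
  imports Defs
begin

text \<open>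
  For a fixed \<open>n\<close>, an edge-colouring of \<open>K\<^sub>n\<close> without rainbow \<open>P\<^sub>5\<close> is reduced to one with three colours.
  Write \<open>H\<close> for the disjoint union, \<open>N\<close> for its order and \<open>\<alpha> \<ge> \<beta> \<ge> \<gamma>\<close> for the sums of the \<open>a\<^sub>i\<close>, \<open>b\<^sub>i\<close>, \<open>c\<^sub>i\<close>.
  Since \<open>H\<close> is not bipartite, \<open>R\<^sub>3(H) \<ge> max (2N - 1) 9 \<ge> N + 4\<close>. If at least four colours occur and some
  vertex sees three of them, then there is a four-vertex set outside of which everything is
  monochromatic. If every vertex sees at most two colours, then one colour \<open>q\<close> is common to all
  vertices and the other colours live inside disjoint parts with all edges between parts
  coloured \<open>q\<close>. Recolour by three colours: \<open>q\<close>, the colour of the largest part, and a single colour for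
  the other non-\<open>q\<close> edges. A monochromatic \<open>H\<close> in the last colour that is not already monochromatic
  shows, since by (ii) every component has at least \<open>\<gamma>\<close> vertices, that at least \<open>N\<close> vertices lie outside
  the largest part and at least \<open>\<gamma>\<close> outside the two largest; by (i) the complete multipartite graph in
  colour \<open>q\<close> then contains \<open>H\<close>, found by filling the three colour classes greedily with parts.
\<close>

section \<open>Colourings without a rainbow path\<close>

text \<open>The colouring is a function of two vertices, with symmetry a separate assumption where
  needed, so that paths are plain vertex lists; later \<open>d x y\<close> is
  \<open>c {x, y}\<close>.\<close>

definition rainbow_P5_free :: "'v set \<Rightarrow> ('v \<Rightarrow> 'v \<Rightarrow> nat) \<Rightarrow> bool" where
  "rainbow_P5_free V d \<longleftrightarrow>
     (\<forall>p\<in>V. \<forall>q\<in>V. \<forall>r\<in>V. \<forall>s\<in>V. \<forall>t\<in>V.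
        distinct [p, q, r, s, t] \<longrightarrow> \<not> distinct [d p q, d q r, d r s, d s t])"

lemma rainbow_P5_freeD:
  assumes "rainbow_P5_free V d" "{p, q, r, s, t} \<subseteq> V" "distinct [p, q, r, s, t]"
  shows "\<not> distinct [d p q, d q r, d r s, d s t]"
  using assms unfolding rainbow_P5_free_def by blast

text \<open>A rainbow paw is a triangle \<open>v x y\<close> with a pendant edge \<open>v z\<close>, its four edges having distinct colours.
  It forces \<open>d u z = d u w\<close> for all further \<open>u\<close>, \<open>w\<close>, and hence one colour outside it.\<close>

lemma rainbow_paw_end:
  assumes free: "rainbow_P5_free V d" and sym: "\<And>x y. d x y = d y x"
    and V: "{v, x, y, z, u} \<subseteq> V" and dist: "distinct [v, x, y, z, u]"
    and paw: "distinct [d v x, d v y, d v z, d x y]"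
  shows "d u z \<in> {d v z, d x y}" "d u y \<in> {d v x, d v z, d x y}" "d u x \<in> {d v y, d v z, d x y}"
proof -
  note P = rainbow_P5_freeD[OF free]
  note S = sym[of x v] sym[of y v] sym[of z v] sym[of y x] sym[of x u] sym[of y u] sym[of z u]
  \<comment> \<open>The paths \<open>u z v x y\<close> and \<open>u z v y x\<close> confine
    \<open>d u z\<close> to \<open>{d v z, d v x, d x y}\<close> and to
    \<open>{d v z, d v y, d x y}\<close>; the claim is the intersection.\<close>
  show "d u z \<in> {d v z, d x y}"
    using P[of u z v x y] P[of u z v y x] V dist paw by (auto simp: S)
  show "d u y \<in> {d v x, d v z, d x y}"
    using P[of z v x y u] V dist paw by (auto simp: S)
  show "d u x \<in> {d v y, d v z, d x y}"
    using P[of z v y x u] V dist paw by (auto simp: S)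
qed

text \<open>If \<open>u w\<close> avoided the triangle colour \<open>d x y\<close>, excluding
  rainbow paths would force in turn \<open>d u w = d v z\<close>, \<open>d u y = d v x\<close>,
  \<open>d u x = d v y\<close> and \<open>d w z = d x y\<close>, making \<open>v y u w z\<close>
  rainbow.\<close>

lemma rainbow_paw_determines_triangle_case:
  assumes free: "rainbow_P5_free V d" and sym: "\<And>x y. d x y = d y x"
    and V: "{v, x, y, z, u, w} \<subseteq> V" and dist: "distinct [v, x, y, z, u, w]"
    and paw: "distinct [d v x, d v y, d v z, d x y]"
    and uz: "d u z = d x y"
  shows "d u w = d x y"
proof (rule ccontr)
  assume neq: "d u w \<noteq> d x y"
  note P = rainbow_P5_freeD[OF free]
  note S = sym[of x v] sym[of y v] sym[of z v] sym[of y x] sym[of z x] sym[of z y]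
    sym[of v u] sym[of x u] sym[of y u] sym[of z u] sym[of v w] sym[of x w] sym[of y w] sym[of z w]
    sym[of w u]
  have u: "d u y \<in> {d v x, d v z, d x y}" "d u x \<in> {d v y, d v z, d x y}"
    and wz: "d w z \<in> {d v z, d x y}"
    using rainbow_paw_end[OF free sym _ _ paw] V dist by auto
  have uw: "d u w = d v z"
    using P[of w u z v x] P[of w u z v y] neq uz V dist paw by (auto simp: S)
  have uy: "d u y = d v x"
    using P[of z u y v x] P[of w u y v x] u(1) uw uz V dist paw by (auto simp: S)
  have ux: "d u x = d v y"
    using P[of z u x v y] P[of w u x v y] u(2) uw uz V dist paw by (auto simp: S)
  have "d w z = d x y"
    using P[of v x u z w] wz ux uz V dist paw by (auto simp: S)
  then show False
    using P[of v y u w z] uy uw V dist paw by (auto simp: S)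
qed

text \<open>This treats the case that \<open>u z\<close> repeats the pendant colour. It serves
  twice: exchanging \<open>x\<close> and \<open>y\<close> preserves the paw, so \<open>u x\<close>
  gets the pendant colour as well.\<close>

lemma rainbow_paw_second_neighbor:
  assumes free: "rainbow_P5_free V d" and sym: "\<And>x y. d x y = d y x"
    and V: "{v, x, y, z, u, w} \<subseteq> V" and dist: "distinct [v, x, y, z, u, w]"
    and paw: "distinct [d v x, d v y, d v z, d x y]"
    and uz: "d u z = d v z" and uw: "d u w \<noteq> d v z"
  shows "d u y = d v z"
proof (rule ccontr)
  assume neq: "d u y \<noteq> d v z"
  note P = rainbow_P5_freeD[OF free]
  note S = sym[of x v] sym[of y v] sym[of z v] sym[of y x] sym[of z x] sym[of z y]
    sym[of v u] sym[of x u] sym[of y u] sym[of z u] sym[of v w] sym[of x w] sym[of y w] sym[of z w]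
    sym[of w u]
  have u: "d u y \<in> {d v x, d v z, d x y}"
    and w: "d w z \<in> {d v z, d x y}" "d w y \<in> {d v x, d v z, d x y}" "d w x \<in> {d v y, d v z, d x y}"
    using rainbow_paw_end[OF free sym _ _ paw] V dist by auto
  have uy: "d u y = d v x"
    using P[of z u y v x] u neq uz V dist paw by (auto simp: S)
  have k: "d u w \<in> {d v x, d v y}"
    using P[of w u y v z] uw uy V dist paw by (auto simp: S)
  have "d w z \<noteq> d x y"
    using rainbow_paw_determines_triangle_case[OF free sym _ _ paw, of w u] k V dist paw by (auto simp: S)
  then have wz: "d w z = d v z"
    using w(1) by simp
  have "d w x \<noteq> d x y"
    using P[of z w x v y] wz V dist paw by (auto simp: S)
  moreover have "d w x \<noteq> d v y"
    using P[of z u y x w] uy uz V dist paw by (auto simp: S)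
  ultimately have wx: "d w x = d v z"
    using w(3) by simp
  have "d u w = d v y"
    using P[of u w x y v] k wx V dist paw by (auto simp: S)
  then show False
    using P[of z w u y x] wz uy V dist paw by (auto simp: S)
qed

text \<open>If the colours differ, the triangle case leaves only the pendant colour for
  \<open>u z\<close>, hence also for \<open>u y\<close> and \<open>u x\<close>. Then
  \<open>u w\<close> must have the triangle colour, and \<open>w u x v y\<close> is rainbow.\<close>

lemma rainbow_paw_determines:
  assumes free: "rainbow_P5_free V d" and sym: "\<And>x y. d x y = d y x"
    and V: "{v, x, y, z, u, w} \<subseteq> V" and dist: "distinct [v, x, y, z, u, w]"
    and paw: "distinct [d v x, d v y, d v z, d x y]"
  shows "d u z = d u w"
proof (rule ccontr)
  assume neq: "d u z \<noteq> d u w"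
  note P = rainbow_P5_freeD[OF free]
  note S = sym[of x v] sym[of y v] sym[of z v] sym[of y x] sym[of z x] sym[of z y]
    sym[of v u] sym[of x u] sym[of y u] sym[of z u] sym[of v w] sym[of x w] sym[of y w] sym[of z w]
    sym[of w u]
  have uz: "d u z = d v z"
    using rainbow_paw_end(1)[OF free sym _ _ paw, of u]
      rainbow_paw_determines_triangle_case[OF free sym V dist paw] neq V dist by auto
  have paw': "distinct [d v y, d v x, d v z, d y x]"
    using paw by (auto simp: S)
  have uy: "d u y = d v z"
    using rainbow_paw_second_neighbor[OF free sym V dist paw uz] neq uz by simp
  have ux: "d u x = d v z"
    using rainbow_paw_second_neighbor[OF free sym _ _ paw' uz, of w] neq uz V dist by auto
  have "d u w = d x y"
    using P[of w u y x v] P[of w u x y v] ux uy uz neq V dist paw by (auto simp: S)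
  then show False
    using P[of w u x v y] ux V dist paw by (auto simp: S)
qed

text \<open>Without a paw, \<open>v\<close> sees only the three star colours, so the edge
  \<open>p q\<close> of a fourth colour avoids \<open>v\<close>. If \<open>d v p\<close> and
  \<open>d v q\<close> differ, a leg in the remaining colour completes a paw; if they agree, legs in
  the other two colours lead to \<open>mono_pair\<close>.\<close>

lemma ex_rainbow_paw:
  assumes free: "rainbow_P5_free V d" and sym: "\<And>x y. d x y = d y x"
    and V: "{v, x, y, z} \<subseteq> V" and dist: "distinct [v, x, y, z]"
    and star: "distinct [d v x, d v y, d v z]"
    and pq: "p \<in> V" "q \<in> V" "p \<noteq> q" "d p q \<notin> {d v x, d v y, d v z}"
  shows "\<exists>v x y z. {v, x, y, z} \<subseteq> V \<and> distinct [v, x, y, z]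
      \<and> distinct [d v x, d v y, d v z, d x y]"
proof (rule ccontr)
  assume "\<not> ?thesis"
  then have no_paw: "\<not> distinct [d v x, d v y, d v z, d x y]"
    if "{v, x, y, z} \<subseteq> V" "distinct [v, x, y, z]" for v x y z
    using that by blast
  note P = rainbow_P5_freeD[OF free]
  have tri: "d x y \<in> {d v x, d v y, d v z}"
    if "{x, y, z} \<subseteq> V" "v \<notin> {x, y, z}" "distinct [x, y, z]" "distinct [d v x, d v y, d v z]"
    for x y z
    using no_paw[of v x y z] that V by auto
  have v3: "d v u \<in> {d v x, d v y, d v z}" if u: "u \<in> V" "u \<noteq> v" for u
  proof (rule ccontr)
    assume new: "d v u \<notin> {d v x, d v y, d v z}"
    then have xyzu: "distinct [x, y, z, u]" "v \<notin> {x, y, z, u}" "distinct [d v x, d v y, d v z, d v u]"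
      using dist star u by auto
    \<comment> \<open>Comparing the stars \<open>x, y, z\<close> and \<open>x, y, u\<close> confines
      \<open>d x y\<close>, and similarly \<open>d z u\<close>; each of the four remaining cases has
      a rainbow path through \<open>v\<close>.\<close>
    have "d x y \<in> {d v x, d v y}" "d z u \<in> {d v z, d v u}"
      using tri[of x y z] tri[of x y u] tri[of z u x] tri[of z u y] V u xyzu by auto
    then show False
      using P[of x y v z u] P[of x y v u z] P[of y x v z u] P[of y x v u z] V u xyzu
      by (auto simp: sym[of _ v] sym[of y x] sym[of u z])
  qed
  have mono_pair: False if pqyz: "{p, q, y, z} \<subseteq> V" "distinct [v, p, q, y, z]" "d v p = d v q"
    "distinct [d v p, d v y, d v z, d p q]" for p q y z
  proof -
    \<comment> \<open>Otherwise \<open>p\<close> is the centre of a paw with triangle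
      \<open>p v y\<close> and pendant edge \<open>p q\<close>.\<close>
    have "d p y \<noteq> d v z"
      using no_paw[of p v y q] pqyz V by (auto simp: sym[of _ v])
    moreover have "d p y \<in> {d v p, d v y, d v z}"
      using tri[of p y z] pqyz by auto
    ultimately have "d p y = d v y"
      using P[of q p y v z] pqyz V by (auto simp: sym[of _ v] sym[of q p])
    then show False
      using P[of y p q v z] pqyz V by (auto simp: sym[of _ v] sym[of y p])
  qed
  have "p \<noteq> v" "q \<noteq> v"
    using v3[of p] v3[of q] pq sym[of p q] by auto
  then have p: "d v p \<in> {d v x, d v y, d v z}" and q: "d v q \<in> {d v x, d v y, d v z}"
    using v3 pq by auto
  have differ: False if "r \<in> {x, y, z}" "d v r \<notin> {d v p, d v q}" "d v p \<noteq> d v q" for r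
  proof -
    have "{v, p, q, r} \<subseteq> V" "distinct [v, p, q, r]"
      using that pq(1-3) \<open>p \<noteq> v\<close> \<open>q \<noteq> v\<close> V dist by auto
    moreover have "d p q \<noteq> d v p" "d p q \<noteq> d v q" "d p q \<noteq> d v r"
      using p q pq(4) that(1) by auto
    ultimately show False
      using no_paw[of v p q r] that(2,3) by simp
  qed
  have same: False if "r \<in> {x, y, z}" "r' \<in> {x, y, z}" "distinct [d v p, d v r, d v r']"
    "d v p = d v q" for r r'
  proof -
    have "{p, q, r, r'} \<subseteq> V" "distinct [v, p, q, r, r']"
      using that pq(1-3) \<open>p \<noteq> v\<close> \<open>q \<noteq> v\<close> V dist by auto
    moreover have "d p q \<noteq> d v p" "d p q \<noteq> d v r" "d p q \<noteq> d v r'"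
      using p pq(4) that(1,2) by auto
    ultimately show False
      using mono_pair[of p q r r'] that(3,4) by simp
  qed
  show False
  proof (cases "d v p = d v q")
    case True
    then show False
      using p same[of x y] same[of x z] same[of y z] star by auto
  next
    case False
    then show False
      using p q differ[of x] differ[of y] differ[of z] star by auto
  qed
qed

text \<open>Any two palettes share the colour of the joining edge. If no colour lay in all palettes,
  three of them would be \<open>{p, r}\<close>, \<open>{r, t}\<close> and \<open>{p, t}\<close>; a
  palette of at most two colours that meets all three lies in \<open>{p, r, t}\<close>, so no fourth
  colour could occur.\<close>

lemma local_two_coloring_dominant:
  fixes d :: "'v \<Rightarrow> 'v \<Rightarrow> nat"
  assumes sym: "\<And>x y. d x y = d y x"
    and two: "\<And>v x y z. {v, x, y, z} \<subseteq> V \<Longrightarrow> v \<notin> {x, y, z} \<Longrightarrow> \<not> distinct [d v x, d v y, d v z]"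
    and four: "\<And>p q r. \<exists>x\<in>V. \<exists>y\<in>V. x \<noteq> y \<and> d x y \<notin> {p, q, r}"
  shows "\<exists>q h. \<forall>x\<in>V. \<forall>y\<in>V. x \<noteq> y \<longrightarrow> d x y = q \<or> (d x y = h x \<and> d x y = h y)"
proof -
  define sees where "sees v k \<longleftrightarrow> (\<exists>x\<in>V. x \<noteq> v \<and> d v x = k)" for v k
  have two': "\<not> distinct [i, j, k]" if "v \<in> V" "sees v i" "sees v j" "sees v k" for v i j k
    using two[of v] that unfolding sees_def by blast
  have edge: "sees u (d u w)" "sees w (d u w)" if "u \<in> V" "w \<in> V" "u \<noteq> w" for u w
    using that sym[of u w] unfolding sees_def by metis+
  have "\<exists>q. \<forall>v\<in>V. sees v q"
  proof (rule ccontr)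
    assume "\<not> ?thesis"
    then have miss: "\<exists>v\<in>V. \<not> sees v q" for q
      by blast
    obtain x y where x: "x \<in> V" and y: "y \<in> V" "x \<noteq> y"
      using four by blast
    define p where "p = d x y"
    have xp: "sees x p"
      using edge x y p_def by blast
    obtain u where u: "u \<in> V" "\<not> sees u p"
      using miss by blast
    have "u \<noteq> x"
      using u xp by blast
    define r where "r = d u x"
    have ur: "sees u r" and xr: "sees x r"
      using edge[of u x] x u \<open>u \<noteq> x\<close> r_def by auto
    obtain w where w: "w \<in> V" "\<not> sees w r"
      using miss by blast
    have "w \<noteq> x" "w \<noteq> u"
      using w xr ur by blast+
    have "p \<noteq> r"
      using u ur by blast
    have x_pal: "k \<in> {p, r}" if "sees x k" for k
      using two'[OF x xp xr that] \<open>p \<noteq> r\<close> by auto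
    have wp: "sees w p"
      using edge[of w x] x_pal[of "d w x"] w x \<open>w \<noteq> x\<close> by auto
    \<comment> \<open>Since \<open>u\<close> misses \<open>p\<close> and \<open>w\<close> misses
      \<open>r\<close>, this is a third colour.\<close>
    define t where "t = d u w"
    have ut: "sees u t" and wt: "sees w t"
      using edge[of u w] u w \<open>w \<noteq> u\<close> t_def by auto
    have ne: "distinct [p, r, t]"
      using \<open>p \<noteq> r\<close> u w ut wt by auto
    have u_pal: "k \<in> {r, t}" if "sees u k" for k
      using two'[OF u(1) ur ut that] ne by auto
    have w_pal: "k \<in> {p, t}" if "sees w k" for k
      using two'[OF w(1) wp wt that] ne by auto
    have "k \<in> {p, r, t}" if v: "v \<in> V" and vk: "sees v k" for v k
    proof (cases "v \<in> {x, u, w}")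
      case True
      then show ?thesis
        using x_pal u_pal w_pal vk by blast
    next
      case False
      then have "d v x \<in> {p, r}" "d v u \<in> {r, t}" "d v w \<in> {p, t}"
        and s: "sees v (d v x)" "sees v (d v u)" "sees v (d v w)"
        using edge[OF v x] edge[OF v u(1)] edge[OF v w(1)] x_pal u_pal w_pal by auto
      then obtain i j where "i \<noteq> j" "{i, j} \<subseteq> {p, r, t}" "sees v i" "sees v j"
        using ne by (cases "d v x = p") (auto intro: that[of "d v x" "d v u"] that[of "d v x" "d v w"])
      then show ?thesis
        using two'[OF v _ _ vk, of i j] by auto
    qed
    then show False
      using four[of p r t] edge by blast
  qed
  then obtain q where q: "\<And>v. v \<in> V \<Longrightarrow> sees v q"
    by blast
  \<comment> \<open>Where only \<open>q\<close> is seen, the value is unspecified; only edges not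
    coloured \<open>q\<close> constrain \<open>h\<close>.\<close>
  define h where "h v = (SOME k. k \<noteq> q \<and> sees v k)" for v
  have h: "h v = k" if "v \<in> V" "k \<noteq> q" "sees v k" for v k
  proof -
    have "h v \<noteq> q \<and> sees v (h v)"
      unfolding h_def using that by (intro someI) auto
    then show ?thesis
      using two'[OF that(1) q[OF that(1)] that(3), of "h v"] that(2) by auto
  qed
  show ?thesis
  proof (intro exI ballI impI)
    fix x y assume "x \<in> V" "y \<in> V" "x \<noteq> y"
    then show "d x y = q \<or> (d x y = h x \<and> d x y = h y)"
      using h edge by metis
  qed
qed

section \<open>Complete multipartite graphs\<close>

text \<open>Elements are added until the sum reaches \<open>k\<close>; the last one contributes at
  most \<open>m\<close>, so the overshoot is below \<open>m\<close>.\<close>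

lemma greedy_subset_sum:
  fixes f :: "'j \<Rightarrow> nat"
  assumes "finite J" "\<And>j. j \<in> J \<Longrightarrow> f j \<le> m" "k \<le> sum f J" "0 < m"
  shows "\<exists>I\<subseteq>J. k \<le> sum f I \<and> sum f I < k + m"
  using assms
proof (induction J rule: finite_induct)
  case empty
  then show ?case by auto
next
  case (insert x J)
  show ?case
  proof (cases "k \<le> sum f J")
    case True
    then show ?thesis
      using insert.IH insert.prems by (meson insertCI subset_insertI2)
  next
    case False
    then have "sum f (insert x J) < k + m"
      using insert.hyps insert.prems(1)[of x] by simp
    then show ?thesis
      using insert.prems(2) by blast
  qed
qed

text \<open>The groups will host the three colour classes of the graph. A large part forms a group
  alone; when parts are small, greedy filling wastes little.\<close>

lemma ex_three_part_groups:
  fixes h :: "'v \<Rightarrow> 'j" and V :: "'v set" and \<alpha> \<beta> \<gamma> :: nat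
  defines "F I \<equiv> card {v \<in> V. h v \<in> I}"
  assumes fin: "finite V" and j: "j\<^sub>1 \<noteq> j\<^sub>2"
    and max1: "\<And>j. F {j} \<le> F {j\<^sub>1}" and max2: "\<And>j. j \<noteq> j\<^sub>1 \<Longrightarrow> F {j} \<le> F {j\<^sub>2}"
    and big1: "\<alpha> + \<beta> + \<gamma> \<le> F (- {j\<^sub>1})" and big2: "\<gamma> \<le> F (- {j\<^sub>1, j\<^sub>2})"
    and V: "2 * (\<alpha> + \<beta> + \<gamma>) \<le> card V + 1"
    and sizes: "0 < \<beta>" "\<beta> \<le> \<alpha>" "\<alpha> \<le> \<beta> + \<gamma>"
  shows "\<exists>A B C. A \<inter> B = {} \<and> A \<inter> C = {} \<and> B \<inter> C = {} \<and> \<alpha> \<le> F A \<and> \<beta> \<le> F B \<and> \<gamma> \<le> F C"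
proof -
  define f where "f j = F {j}" for j
  have F_sum: "F I = sum f I" if "finite I" for I
  proof -
    have "{v \<in> V. h v \<in> I} = (\<Union>j\<in>I. {v \<in> V. h v \<in> {j}})"
      by auto
    then show ?thesis
      unfolding F_def f_def using fin that
      by (simp only:) (rule card_UN_disjoint, auto)
  qed
  \<comment> \<open>The index type may be infinite, so complements are cut down to the indices of
    nonempty parts.\<close>
  have F_Int: "F (I \<inter> h ` V) = F I" for I
    unfolding F_def by (rule arg_cong[where f = card]) auto
  have finJ: "finite (h ` V)"
    using fin by simp
  show ?thesis
  proof (cases "\<alpha> \<le> f j\<^sub>1")
    case a: True
    show ?thesis
    proof (cases "\<beta> \<le> f j\<^sub>2")
      case True
      then show ?thesis
        using a big2 j f_def by (intro exI[of _ "{j\<^sub>1}"] exI[of _ "{j\<^sub>2}"] exI[of _ "- {j\<^sub>1, j\<^sub>2}"]) auto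
    next
      case False
      define J where "J = - {j\<^sub>1} \<inter> h ` V"
      have J: "finite J" "sum f J = F (- {j\<^sub>1})"
        using finJ F_Int F_sum unfolding J_def by (metis finite_Int)+
      have "f j \<le> \<beta>" if "j \<in> J" for j
        using max2[of j] that False unfolding J_def f_def by auto
      then obtain I where I: "I \<subseteq> J" "\<beta> \<le> sum f I" "sum f I < \<beta> + \<beta>"
        using greedy_subset_sum[OF J(1), of f \<beta> \<beta>] J(2) big1 sizes by auto
      have "sum f (J - I) = sum f J - sum f I"
        using J(1) I(1) by (intro sum_diff_nat) (auto intro: finite_subset)
      \<comment> \<open>\<open>I\<close> uses at most 2\<beta> - 1 of at least \<alpha> + \<beta> +
        \<gamma> vertices, and \<beta> \<le> \<alpha>.\<close>
      then have "\<gamma> \<le> F (J - I)" "\<beta> \<le> F I"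
        using I J big1 sizes F_sum[of "J - I"] F_sum[of I] finite_subset[OF I(1)] by auto
      then show ?thesis
        using a I(1) f_def unfolding J_def
        by (intro exI[of _ "{j\<^sub>1}"] exI[of _ I] exI[of _ "J - I"]) (auto simp: J_def)
    qed
  next
    case False
    define J where "J = h ` V"
    have "{v \<in> V. h v \<in> J} = V"
      unfolding J_def by auto
    then have J: "finite J" "sum f J = card V"
      using finJ F_sum[of J] unfolding J_def F_def by simp_all
    have small: "f j \<le> \<alpha>" for j
      using max1[of j] False unfolding f_def by auto
    then obtain A where A: "A \<subseteq> J" "\<alpha> \<le> sum f A" "sum f A < \<alpha> + \<alpha>"
      using greedy_subset_sum[OF J(1), of f \<alpha> \<alpha>] J(2) V sizes by auto
    have JA: "sum f (J - A) = card V - sum f A"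
      using J A(1) by (subst sum_diff_nat) (auto intro: finite_subset)
    \<comment> \<open>\<open>A\<close> uses at most 2\<alpha> - 1 of at least 2(\<alpha> + \<beta> +
      \<gamma>) - 1 vertices, leaving 2\<beta> + 2\<gamma>. \<open>B\<close> will use at most
      \<alpha> + \<beta> - 1 of these, and \<alpha> \<le> \<beta> + \<gamma> then leaves
      \<gamma>.\<close>
    have "\<beta> \<le> card V - sum f A"
      using A(3) V by arith
    then obtain B where B: "B \<subseteq> J - A" "\<beta> \<le> sum f B" "sum f B < \<beta> + \<alpha>"
      using greedy_subset_sum[of "J - A" f \<alpha> \<beta>] JA J(1) small sizes by auto
    have "sum f (J - A - B) = sum f (J - A) - sum f B"
      using J B(1) by (subst sum_diff_nat) (auto intro: finite_subset)
    then have "\<gamma> \<le> sum f (J - A - B)"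
      using JA A B V sizes by simp
    moreover have "finite A" "finite B" "finite (J - A - B)"
      using J(1) A(1) B(1) by (auto intro: finite_subset)
    ultimately have "\<alpha> \<le> F A" "\<beta> \<le> F B" "\<gamma> \<le> F (J - A - B)"
      using A B F_sum by auto
    then show ?thesis
      using B(1) by (intro exI[of _ A] exI[of _ B] exI[of _ "J - A - B"]) auto
  qed
qed

section \<open>Monochromatic copies in complete graphs\<close>

lemma edge_complete_graph_iff [simp]:
  "{x, y} \<in> edges (complete_graph n) \<longleftrightarrow> x < n \<and> y < n \<and> x \<noteq> y"
  by (auto simp: complete_graph_def card_2_iff doubleton_eq_iff)

lemma simple_graph_edgeE:
  assumes "simple_graph H" "e \<in> edges H"
  obtains x y where "e = {x, y}" "x \<noteq> y" "x \<in> verts H" "y \<in> verts H"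
proof -
  have "card e = 2" "e \<subseteq> verts H"
    using assms unfolding simple_graph_def by auto
  then show ?thesis
    using that by (metis card_2_iff insert_subset)
qed

lemma has_monochromatic_completeI:
  assumes H: "simple_graph H" and g: "inj_on g (verts H)" "g ` verts H \<subseteq> {..<n}"
    and mono: "\<And>x y. {x, y} \<in> edges H \<Longrightarrow> c {g x, g y} = k"
  shows "has_monochromatic H (complete_graph n) c"
proof -
  have "g ` e \<in> edges (complete_graph n) \<and> c (g ` e) = k" if "e \<in> edges H" for e
    using H that
  proof (rule simple_graph_edgeE)
    fix x y assume e: "e = {x, y}" "x \<noteq> y" "x \<in> verts H" "y \<in> verts H"
    then have "g x \<noteq> g y"
      using g(1) by (auto dest: inj_onD)
    then show ?thesis
      using e g(2) mono[of x y] that by auto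
  qed
  moreover have "g ` verts H \<subseteq> verts (complete_graph n)"
    using g(2) by (simp add: complete_graph_def)
  ultimately show ?thesis
    using g(1) unfolding has_monochromatic_def graph_embedding_def by blast
qed

lemma monochromatic_clique_contains:
  assumes H: "simple_graph H" and X: "X \<subseteq> {..<n}" "card (verts H) \<le> card X"
    and mono: "\<And>x y. x \<in> X \<Longrightarrow> y \<in> X \<Longrightarrow> x \<noteq> y \<Longrightarrow> c {x, y} = k"
  shows "has_monochromatic H (complete_graph n) c"
proof -
  have "finite (verts H)" "finite X"
    using H X(1) finite_subset unfolding simple_graph_def by auto
  then obtain g where g: "g ` verts H \<subseteq> X" "inj_on g (verts H)"
    using card_le_inj[of "verts H" X] X(2) by blast
  show ?thesis
  proof (rule has_monochromatic_completeI[OF H g(2)])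
    show "c {g x, g y} = k" if e: "{x, y} \<in> edges H" for x y
    proof -
      have "x \<noteq> y" "x \<in> verts H" "y \<in> verts H"
        using e H unfolding simple_graph_def by (auto simp: card_insert_if split: if_splits)
      then show ?thesis
        using g mono[of "g x" "g y"] by (auto dest: inj_onD)
    qed
  qed (use g(1) X(1) in blast)
qed

section \<open>Lower bounds for three-colour Ramsey numbers by cuts\<close>

definition crosses :: "('b \<Rightarrow> bool) \<Rightarrow> 'b set \<Rightarrow> bool" where
  "crosses P e \<longleftrightarrow> (\<exists>x\<in>e. \<exists>y\<in>e. P x \<noteq> P y)"

text \<open>\<open>P\<close> pulled back along \<open>g\<close> is a proper 2-colouring. Hence a
  colour class contained in a cut holds no copy of a non-bipartite graph.\<close>

lemma crossing_edges_bipartite: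
  assumes H: "simple_graph H"
    and cut: "\<And>e. e \<in> edges H \<Longrightarrow> crosses P (g ` e)"
  shows "bipartite_graph H"
  unfolding bipartite_graph_def proper_coloring_def
proof (intro exI conjI ballI allI impI)
  fix u v assume "{u, v} \<in> edges H"
  then show "(if P (g u) then 0 else 1 :: nat) \<noteq> (if P (g v) then 0 else 1)"
    using cut[of "{u, v}"] unfolding crosses_def by auto
qed auto

text \<open>\<open>ramsey3 H\<close> is the least such \<open>n\<close>. Fixing \<open>n\<close>
  lets the two Ramsey numbers be compared order by order.\<close>

definition arrows3 :: "'a ugraph \<Rightarrow> nat \<Rightarrow> bool" where
  "arrows3 H n \<longleftrightarrow>
     (\<forall>c. c ` edges (complete_graph n) \<subseteq> {1, 2, 3} \<longrightarrow> has_monochromatic H (complete_graph n) c)"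

lemma arrows3E:
  fixes c :: "nat set \<Rightarrow> nat"
  assumes "arrows3 H n" "\<And>e. c e \<in> {1, 2, 3}"
  obtains g k where "graph_embedding g H (complete_graph n)" "\<And>e. e \<in> edges H \<Longrightarrow> c (g ` e) = k"
proof -
  have "has_monochromatic H (complete_graph n) c"
    using assms unfolding arrows3_def by blast
  then show ?thesis
    using that unfolding has_monochromatic_def by blast
qed

text \<open>Colouring the edges of \<open>K\<^sub>8\<close> by the first binary digit in which the ends differ makes every colour
  class bipartite.\<close>

lemma arrows3_ge_9:
  assumes H: "simple_graph H" "\<not> bipartite_graph H" and arr: "arrows3 H n"
  shows "9 \<le> n"
proof (rule ccontr)
  assume "\<not> 9 \<le> n"
  define c :: "nat set \<Rightarrow> nat" where
    "c e = (if crosses (\<lambda>x. x < 4) e then 1 else if crosses (\<lambda>x. x mod 4 < 2) e then 2 else 3)" for e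
  have c: "c e \<in> {1, 2, 3}" for e
    unfolding c_def by simp
  obtain g k where g: "graph_embedding g H (complete_graph n)"
    and k: "\<And>e. e \<in> edges H \<Longrightarrow> c (g ` e) = k"
    using arrows3E[of H n c] arr c by blast
  have cut: False if "\<And>e. e \<in> edges H \<Longrightarrow> crosses P (g ` e)" for P
    using crossing_edges_bipartite[OF H(1), of P g] that H(2) by blast
  have c_cases: "c e = 1 \<longleftrightarrow> crosses (\<lambda>x. x < 4) e"
    "c e = 2 \<longleftrightarrow> \<not> crosses (\<lambda>x. x < 4) e \<and> crosses (\<lambda>x. x mod 4 < 2) e" for e
    unfolding c_def by simp_all
  have even: "crosses even e"
    if "e \<in> edges (complete_graph n)" "\<not> crosses (\<lambda>x. x < 4) e" "\<not> crosses (\<lambda>x. x mod 4 < 2) e" for e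
  proof -
    obtain x y where e: "e = {x, y}" "x \<noteq> y" "x < 8" "y < 8"
    proof -
      obtain x y where "e = {x, y}" "x \<noteq> y" "e \<subseteq> {..<n}"
        using \<open>e \<in> edges (complete_graph n)\<close> by (auto simp: complete_graph_def card_2_iff)
      then show thesis
        using that \<open>\<not> 9 \<le> n\<close> by auto
    qed
    have "(x < 4) = (y < 4)" "(x mod 4 < 2) = (y mod 4 < 2)"
      using that(2,3) e(1) unfolding crosses_def by blast+
    then have "even x \<noteq> even y"
      using e(2-4) by presburger
    then show ?thesis
      using e(1) unfolding crosses_def by blast
  qed
  have edge: "g ` e \<in> edges (complete_graph n)" if "e \<in> edges H" for e
    using g that unfolding graph_embedding_def by blast
  consider "k = 1" | "k = 2" | "k \<notin> {1, 2}"
    by blast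
  then show False
  proof cases
    case 1
    then show False
      using cut[of "\<lambda>x. x < 4"] k c_cases(1) by blast
  next
    case 2
    then show False
      using cut[of "\<lambda>x. x mod 4 < 2"] k c_cases(2) by blast
  next
    case 3
    then show False
      using cut[of even] k even[OF edge] c_cases by blast
  qed
qed

text \<open>Two cliques of order \<open>card (verts H) - 1\<close> in colours 2 and 3, joined by colour 1.\<close>

lemma arrows3_ge_double:
  assumes H: "simple_graph H" "\<not> bipartite_graph H" and cov: "\<And>v. v \<in> verts H \<Longrightarrow> \<exists>e\<in>edges H. v \<in> e"
    and arr: "arrows3 H n"
  shows "2 * card (verts H) \<le> n + 1"
proof (rule ccontr)
  assume small: "\<not> 2 * card (verts H) \<le> n + 1"
  define m where "m = card (verts H) - 1"
  define c :: "nat set \<Rightarrow> nat" where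
    "c e = (if crosses (\<lambda>x. x < m) e then 1 else if e \<subseteq> {..<m} then 2 else 3)" for e
  have c: "c e \<in> {1, 2, 3}" for e
    unfolding c_def by simp
  obtain g k where g: "graph_embedding g H (complete_graph n)"
    and k: "\<And>e. e \<in> edges H \<Longrightarrow> c (g ` e) = k"
    using arrows3E[of H n c] arr c by blast
  have c_cases: "c e = 1 \<longleftrightarrow> crosses (\<lambda>x. x < m) e" "c e = 2 \<longleftrightarrow> \<not> crosses (\<lambda>x. x < m) e \<and> e \<subseteq> {..<m}" for e
    unfolding c_def by simp_all
  have inj: "inj_on g (verts H)" and im: "g ` verts H \<subseteq> {..<n}"
    using g unfolding graph_embedding_def complete_graph_def by auto
  have k1: "k \<noteq> 1"
  proof
    assume "k = 1"
    then have "crosses (\<lambda>x. x < m) (g ` e)" if "e \<in> edges H" for e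
      using k[OF that] c_cases by simp
    then show False
      using crossing_edges_bipartite[OF H(1), of "\<lambda>x. x < m" g] H(2) by blast
  qed
  have too_small: "card (verts H) \<le> card X" if "finite X" "g ` verts H \<subseteq> X" for X
    using card_inj_on_le[OF inj that(2,1)] .
  show False
  proof (cases "k = 2")
    case True
    \<comment> \<open>As every vertex lies on an edge, the clique contains the whole copy and not
      just its edges.\<close>
    have "g v \<in> {..<m}" if "v \<in> verts H" for v
      using cov[OF that] k True c_cases(2) by blast
    then have "card (verts H) \<le> m"
      using too_small[of "{..<m}"] by auto
    then show False
      using small unfolding m_def by simp
  next
    case False
    have "g v \<in> {m..<n}" if v: "v \<in> verts H" for v
    proof -
      obtain e where e: "e \<in> edges H" "v \<in> e"
        using cov[OF v] by blast
      then have "\<not> g ` e \<subseteq> {..<m}" "\<not> crosses (\<lambda>x. x < m) (g ` e)"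
        using k[OF e(1)] k1 False c_cases by blast+
      then have "\<not> g v < m"
        using e(2) unfolding crosses_def by blast
      then show ?thesis
        using im v by auto
    qed
    then have "g ` verts H \<subseteq> {m..<n}"
      by blast
    then have "card (verts H) \<le> n - m"
      using too_small[of "{m..<n}"] by simp
    then show False
      using small unfolding m_def by simp
  qed
qed

text \<open>The palette is renamed to \<open>{1, 2, 3}\<close>. The colours \<open>p\<close>,
  \<open>q\<close>, \<open>r\<close> may coincide: \<open>\<pi>\<close> tests them in order and
  stays injective on the palette.\<close>

lemma arrows3_three_colors:
  assumes arr: "arrows3 H n" and c: "c ` edges (complete_graph n) \<subseteq> {p, q, r}" 
  shows "has_monochromatic H (complete_graph n) c"
proof -
  define \<pi> :: "nat \<Rightarrow> nat" where "\<pi> k = (if k = p then 1 else if k = q then 2 else 3)" for k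
  have \<pi>: "\<pi> k \<in> {1, 2, 3}" for k
    unfolding \<pi>_def by simp
  obtain g k where g: "graph_embedding g H (complete_graph n)"
    and k: "\<And>e. e \<in> edges H \<Longrightarrow> \<pi> (c (g ` e)) = k"
    using arrows3E[of H n "\<lambda>e. \<pi> (c e)"] arr \<pi> by blast
  have "c (g ` e) \<in> {p, q, r}" if "e \<in> edges H" for e
    using c g that unfolding graph_embedding_def by blast
  then have "c (g ` e) = (if k = 1 then p else if k = 2 then q else r)" if "e \<in> edges H" for e
    using k[OF that] that unfolding \<pi>_def by (force split: if_splits)
  then show ?thesis
    using g unfolding has_monochromatic_def by blast
qed


text \<open>Injections of the single classes glue to one injection because the targets are
  disjoint.\<close>

lemma ex_class_embedding:
  assumes H: "simple_graph H" and X: "\<And>j. j < m \<Longrightarrow> finite (X j)"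
    "\<And>i j. i < m \<Longrightarrow> j < m \<Longrightarrow> i \<noteq> j \<Longrightarrow> X i \<inter> X j = {}"
    and le: "\<And>j. j < m \<Longrightarrow> card (color_class H \<psi> j) \<le> card (X j)"
    and \<psi>: "\<And>v. v \<in> verts H \<Longrightarrow> \<psi> v < m"
  shows "\<exists>g. inj_on g (verts H) \<and> (\<forall>v\<in>verts H. g v \<in> X (\<psi> v))"
proof -
  have "\<exists>f. f ` color_class H \<psi> j \<subseteq> X j \<and> inj_on f (color_class H \<psi> j)" if "j < m" for j
  proof (rule card_le_inj)
    show "finite (color_class H \<psi> j)"
      using H unfolding simple_graph_def color_class_def by simp
  qed (use X(1) le that in auto)
  then obtain f where f: "\<And>j. j < m \<Longrightarrow> f j ` color_class H \<psi> j \<subseteq> X j"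
    "\<And>j. j < m \<Longrightarrow> inj_on (f j) (color_class H \<psi> j)"
    by metis
  define g where "g v = f (\<psi> v) v" for v
  have cl: "v \<in> color_class H \<psi> (\<psi> v)" if "v \<in> verts H" for v
    using that unfolding color_class_def by simp
  have gX: "g v \<in> X (\<psi> v)" if "v \<in> verts H" for v
    using f(1)[OF \<psi>[OF that]] cl[OF that] unfolding g_def by blast
  have "inj_on g (verts H)"
  proof (rule inj_onI)
    fix u v assume uv: "u \<in> verts H" "v \<in> verts H" "g u = g v"
    then have "\<psi> u = \<psi> v"
      using gX[of u] gX[of v] X(2)[OF \<psi>[OF uv(1)] \<psi>[OF uv(2)]] by auto
    then show "u = v"
      using f(2)[OF \<psi>[OF uv(1)]] cl[OF uv(1)] cl[OF uv(2)] uv(3) unfolding g_def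
      by (auto dest: inj_onD)
  qed
  then show ?thesis
    using gX by blast
qed

section \<open>Paths on five vertices, and sizes of colour classes\<close>

lemma path_graph_5_edges: "edges (path_graph 5) = {{0, 1}, {1, 2}, {2, 3}, {3, 4}}"
proof -
  have "{{i, Suc i} |i. Suc i < 5} = (\<lambda>i. {i, Suc i}) ` {0, 1, 2, 3}"
    by (auto simp: less_Suc_eq numeral_eq_Suc)
  then show ?thesis
    by (simp add: path_graph_def numeral_eq_Suc)
qed

lemma three_colors_no_rainbow_P5:
  assumes "c ` edges K \<subseteq> {1, 2, 3}"
  shows "\<not> has_rainbow (path_graph 5) K c"
proof
  assume "has_rainbow (path_graph 5) K c"
  then obtain g where g: "graph_embedding g (path_graph 5) K"
    and inj: "inj_on (\<lambda>e. c (g ` e)) (edges (path_graph 5))"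
    unfolding has_rainbow_def by blast
  have "(\<lambda>e. c (g ` e)) ` edges (path_graph 5) \<subseteq> {1, 2, 3}"
    using g assms unfolding graph_embedding_def by blast
  then have "card (edges (path_graph 5)) \<le> card {1, 2, 3 :: nat}"
    using card_inj_on_le[OF inj] by blast
  then show False
    by (simp add: path_graph_5_edges card_insert_if doubleton_eq_iff)
qed

lemma fourth_color_edge:
  assumes "\<And>p q r. \<not> c ` edges (complete_graph n) \<subseteq> {p, q, r}"
  shows "\<exists>x\<in>{..<n}. \<exists>y\<in>{..<n}. x \<noteq> y \<and> c {x, y} \<notin> {p, q, r}"
proof -
  obtain e where e: "e \<in> edges (complete_graph n)" "c e \<notin> {p, q, r}"
    using assms[of p q r] by blast
  obtain x y where xy: "e = {x, y}" "x \<noteq> y" "e \<subseteq> {..<n}"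
    using e(1) by (auto simp: complete_graph_def card_2_iff)
  then show ?thesis
    using e(2) by blast
qed

lemma card_verts_eq_color_classes:
  assumes G: "simple_graph G" and \<phi>: "proper_coloring G 3 \<phi>"
  shows "card (verts G)
    = card (color_class G \<phi> 0) + card (color_class G \<phi> 1) + card (color_class G \<phi> 2)"
proof -
  have "verts G = color_class G \<phi> 0 \<union> color_class G \<phi> 1 \<union> color_class G \<phi> 2"
    using \<phi> unfolding proper_coloring_def color_class_def by (auto simp: less_Suc_eq numeral_eq_Suc)
  moreover have "finite (color_class G \<phi> j)" for j
    using G unfolding simple_graph_def color_class_def by simp
  moreover have "color_class G \<phi> i \<inter> color_class G \<phi> j = {}" if "i \<noteq> j" for i j
    using that unfolding color_class_def by auto
  ultimately show ?thesis
    by (simp add: card_Un_disjoint Int_Un_distrib2)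
qed

lemma third_class_pos:
  assumes G: "simple_graph G" and \<phi>: "proper_coloring G 3 \<phi>" and not2: "\<not> proper_coloring G 2 \<phi>"
  shows "0 < card (color_class G \<phi> 2)"
proof (rule ccontr)
  assume "\<not> ?thesis"
  moreover have "finite (color_class G \<phi> 2)"
    using G unfolding simple_graph_def color_class_def by simp
  ultimately have "color_class G \<phi> 2 = {}"
    by auto
  then have "proper_coloring G 2 \<phi>"
    using \<phi> unfolding proper_coloring_def color_class_def
    by (auto simp: less_Suc_eq numeral_eq_Suc)
  then show False
    using not2 by blast
qed

lemma rainbow_P5_free_if_no_rainbow:
  assumes "\<not> has_rainbow (path_graph 5) (complete_graph n) c"
  shows "rainbow_P5_free {..<n} (\<lambda>x y. c {x, y})"
  unfolding rainbow_P5_free_def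
proof (intro ballI impI notI)
  fix p q r s t
  assume V: "p \<in> {..<n}" "q \<in> {..<n}" "r \<in> {..<n}" "s \<in> {..<n}" "t \<in> {..<n}"
    and dist: "distinct [p, q, r, s, t]"
    and rainbow: "distinct [c {p, q}, c {q, r}, c {r, s}, c {s, t}]"
  define g where "g i = [p, q, r, s, t] ! i" for i
  have g: "g 0 = p" "g 1 = q" "g (Suc 0) = q" "g 2 = r" "g 3 = s" "g 4 = t"
    unfolding g_def by simp_all
  have verts: "verts (path_graph 5) = {0, 1, 2, 3, 4}"
    unfolding path_graph_def by auto
  have "graph_embedding g (path_graph 5) (complete_graph n)"
    unfolding graph_embedding_def path_graph_5_edges verts
    using V dist by (auto simp: g complete_graph_def card_insert_if)
  moreover have "inj_on (\<lambda>e. c (g ` e)) (edges (path_graph 5))"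
    unfolding path_graph_5_edges using rainbow by (auto simp: g)
  ultimately show False
    using assms unfolding has_rainbow_def by blast
qed

section \<open>Reduction to three colours at a fixed order\<close>

text \<open>In \<open>component_size\<close>, a fibre of a function that is constant on edges is a union of components; so the
  assumption says that every component has at least \<open>\<gamma>\<close> vertices.\<close>

locale balanced_3_chromatic =
  fixes H :: "'a ugraph" and \<psi> :: "'a \<Rightarrow> nat" and \<alpha> \<beta> \<gamma> :: nat
  assumes simple: "simple_graph H"
    and not_bipartite: "\<not> bipartite_graph H"
    and no_isolated: "\<And>v. v \<in> verts H \<Longrightarrow> \<exists>e\<in>edges H. v \<in> e"
    and proper: "proper_coloring H 3 \<psi>"
    and classes: "card (color_class H \<psi> 0) = \<alpha>" "card (color_class H \<psi> 1) = \<beta>"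
      "card (color_class H \<psi> 2) = \<gamma>"
    and sizes: "\<gamma> \<le> \<beta>" "\<beta> \<le> \<alpha>" "\<alpha> \<le> \<beta> + \<gamma>"
    and component_size: "\<And>(f :: 'a \<Rightarrow> nat) v. v \<in> verts H \<Longrightarrow>
      (\<And>e x y. e \<in> edges H \<Longrightarrow> x \<in> e \<Longrightarrow> y \<in> e \<Longrightarrow> f x = f y) \<Longrightarrow>
      \<gamma> \<le> card {w \<in> verts H. f w = f v}"
begin

lemma card_verts: "card (verts H) = \<alpha> + \<beta> + \<gamma>"
  using card_verts_eq_color_classes[OF simple proper] classes by simp

lemma gamma_pos: "0 < \<gamma>"
  using third_class_pos[OF simple proper] not_bipartite classes(3)
  unfolding bipartite_graph_def by simp

text \<open>The fibres of \<open>h\<close> are the parts: edges between distinct parts have colour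
  \<open>q\<close>, edges inside part \<open>j\<close> have colour \<open>q\<close> or
  \<open>j\<close>. A copy in the three-colouring \<open>c'\<close> is either monochromatic for
  \<open>c\<close> or shows that the parts can be grouped to hold \<open>H\<close> in colour
  \<open>q\<close>.\<close>

lemma dominant_coloring_monochromatic:
  fixes c :: "nat set \<Rightarrow> nat"
  assumes arr: "arrows3 H n"
    and dom: "\<And>x y. x < n \<Longrightarrow> y < n \<Longrightarrow> x \<noteq> y \<Longrightarrow> c {x, y} = q \<or> (c {x, y} = h x \<and> c {x, y} = h y)"
  shows "has_monochromatic H (complete_graph n) c"
proof (rule ccontr)
  assume no_mono: "\<not> ?thesis"
  define F where "F I = card {v \<in> {..<n}. h v \<in> I}" for I
  have bound: "F {j} \<le> n" for j
    unfolding F_def using card_mono[of "{..<n}" "{v \<in> {..<n}. h v \<in> {j}}"] by auto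
  obtain j\<^sub>1 where max1: "\<And>j. F {j} \<le> F {j\<^sub>1}"
    using ex_has_greatest_nat[of "\<lambda>_. True" 0 "\<lambda>j. F {j}" "Suc n"] bound by (auto simp: less_Suc_eq_le)
  obtain j\<^sub>2 where j: "j\<^sub>2 \<noteq> j\<^sub>1" and max2: "\<And>j. j \<noteq> j\<^sub>1 \<Longrightarrow> F {j} \<le> F {j\<^sub>2}"
    \<comment> \<open>\<open>Suc j\<^sub>1\<close> only witnesses that another index exists; the
      second part may be empty.\<close>
    using ex_has_greatest_nat[of "\<lambda>j. j \<noteq> j\<^sub>1" "Suc j\<^sub>1" "\<lambda>j. F {j}" "Suc n"] bound by (auto simp: less_Suc_eq_le)
  \<comment> \<open>Only a copy of \<open>H\<close> in colour 3 of \<open>c'\<close> need not be monochromatic for \<open>c\<close>.\<close>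
  define c' :: "nat set \<Rightarrow> nat" where
    "c' e = (if c e = q then 1 else if \<forall>x\<in>e. h x = j\<^sub>1 then 2 else 3)" for e
  have "c' e \<in> {1, 2, 3}" for e
    unfolding c'_def by simp
  then obtain g k where g: "graph_embedding g H (complete_graph n)"
    and k: "\<And>e. e \<in> edges H \<Longrightarrow> c' (g ` e) = k"
    using arrows3E[of H n c'] arr by blast
  have c': "c' e = 1 \<longleftrightarrow> c e = q" "c' e = 2 \<longleftrightarrow> c e \<noteq> q \<and> (\<forall>x\<in>e. h x = j\<^sub>1)" for e
    unfolding c'_def by simp_all
  have inj: "inj_on g (verts H)" and im: "g ` verts H \<subseteq> {..<n}"
    and edge: "\<And>e. e \<in> edges H \<Longrightarrow> g ` e \<in> edges (complete_graph n)"
    using g unfolding graph_embedding_def complete_graph_def by auto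
  have not_mono: "\<exists>e\<in>edges H. c (g ` e) \<noteq> l" for l
    using no_mono g unfolding has_monochromatic_def by blast
  have dom_edge: "c e = h x" if "e \<in> edges (complete_graph n)" "x \<in> e" "c e \<noteq> q" for e x
  proof -
    obtain y z where "e = {y, z}" "y \<noteq> z" "e \<subseteq> {..<n}"
      using \<open>e \<in> edges (complete_graph n)\<close> by (auto simp: complete_graph_def card_2_iff)
    then show ?thesis
      using dom[of y z] that(2,3) by auto
  qed
  have "k \<noteq> 1"
    using not_mono[of q] k c'(1) by blast
  then have nq: "c (g ` e) \<noteq> q" if "e \<in> edges H" for e
    using k[OF that] c'(1)[of "g ` e"] by blast
  \<comment> \<open>So \<open>h\<close> composed with \<open>g\<close> is constant on components, as
    \<open>component_size\<close> requires.\<close>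
  have h_edge: "h (g x) = h (g y)" if "e \<in> edges H" "x \<in> e" "y \<in> e" for e x y
    using dom_edge[OF edge[OF that(1)] _ nq[OF that(1)]] that by (metis imageI)
  \<comment> \<open>An edge of colour 2 lies inside part \<open>j\<^sub>1\<close> and avoids
    \<open>q\<close>, so its colour in \<open>c\<close> is \<open>j\<^sub>1\<close>.\<close>
  have "k \<noteq> 2"
  proof
    assume "k = 2"
    then have "c (g ` e) = j\<^sub>1" if e: "e \<in> edges H" for e
    proof -
      obtain x where "x \<in> e"
        using simple_graph_edgeE[OF simple e] by blast
      then show ?thesis
        using k[OF e] \<open>k = 2\<close> c'(2)[of "g ` e"] dom_edge[OF edge[OF e] _ nq[OF e], of "g x"] by auto
    qed
    then show False
      using not_mono by blast
  qed
  have not_j1: "h (g v) \<noteq> j\<^sub>1" if v: "v \<in> verts H" for v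
  proof
    assume hv: "h (g v) = j\<^sub>1"
    obtain e where e: "e \<in> edges H" "v \<in> e"
      using no_isolated[OF v] by blast
    have "h (g x) = j\<^sub>1" if "x \<in> e" for x
      using h_edge[OF e(1) that e(2)] hv by simp
    then have "c' (g ` e) = 2"
      using nq[OF e(1)] c'(2)[of "g ` e"] by auto
    then show False
      using k[OF e(1)] \<open>k \<noteq> 2\<close> by simp
  qed
  have F_ge: "card W \<le> F I" if "W \<subseteq> verts H" "\<And>v. v \<in> W \<Longrightarrow> h (g v) \<in> I" for W I
    unfolding F_def using that im
    by (intro card_inj_on_le[OF inj_on_subset[OF inj that(1)]]) auto
  have big1: "\<alpha> + \<beta> + \<gamma> \<le> F (- {j\<^sub>1})"
    using F_ge[of "verts H" "- {j\<^sub>1}"] not_j1 by (simp add: card_verts)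
  \<comment> \<open>A copy inside part \<open>j\<^sub>2\<close> would be monochromatic in colour
    \<open>j\<^sub>2\<close>. So some vertex lies outside the two largest parts, and with it its
    whole component.\<close>
  have big2: "\<gamma> \<le> F (- {j\<^sub>1, j\<^sub>2})"
  proof -
    have "\<exists>v\<in>verts H. h (g v) \<noteq> j\<^sub>2"
    proof (rule ccontr)
      assume "\<not> ?thesis"
      then have all: "\<And>v. v \<in> verts H \<Longrightarrow> h (g v) = j\<^sub>2"
        by blast
      have "c (g ` e) = j\<^sub>2" if e: "e \<in> edges H" for e
      proof -
        obtain x where "x \<in> e" "x \<in> verts H"
          using simple_graph_edgeE[OF simple e] by blast
        then show ?thesis
          using dom_edge[OF edge[OF e] _ nq[OF e], of "g x"] all by auto
      qed
      then show False
        using not_mono by blast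
    qed
    then obtain v where v: "v \<in> verts H" "h (g v) \<noteq> j\<^sub>2"
      by blast
    have "\<gamma> \<le> card {w \<in> verts H. h (g w) = h (g v)}"
      using component_size[of v "\<lambda>x. h (g x)"] v(1) h_edge by blast
    also have "\<dots> \<le> F (- {j\<^sub>1, j\<^sub>2})"
      using v not_j1[OF v(1)] by (intro F_ge) auto
    finally show ?thesis .
  qed
  have "2 * (\<alpha> + \<beta> + \<gamma>) \<le> card {..<n} + 1"
    using arrows3_ge_double[OF simple not_bipartite no_isolated arr] by (simp add: card_verts)
  then obtain A B C where ABC: "A \<inter> B = {}" "A \<inter> C = {}" "B \<inter> C = {}"
    "\<alpha> \<le> F A" "\<beta> \<le> F B" "\<gamma> \<le> F C"
    using ex_three_part_groups[of "{..<n}" j\<^sub>1 j\<^sub>2 h \<alpha> \<beta> \<gamma>] j max1 max2 big1 big2 sizes gamma_pos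
    unfolding F_def by auto
  \<comment> \<open>Adjacent vertices have distinct values of \<open>\<psi>\<close>, so they are
    sent to different groups, hence to different parts, and their edge gets colour
    \<open>q\<close>.\<close>
  define X where "X i = {v \<in> {..<n}. h v \<in> (if i = 0 then A else if i = 1 then B else C)}" for i :: nat
  have less3: "i < 3 \<longleftrightarrow> i = 0 \<or> i = 1 \<or> i = 2" for i :: nat
    by auto
  have \<psi>: "\<psi> v < 3" if "v \<in> verts H" for v
    using proper that unfolding proper_coloring_def by blast
  have "\<exists>g. inj_on g (verts H) \<and> (\<forall>v\<in>verts H. g v \<in> X (\<psi> v))"
  proof (rule ex_class_embedding[OF simple _ _ _ \<psi>])
    show "finite (X i)" for i
      unfolding X_def by simp
    show "X i \<inter> X l = {}" if "i < 3" "l < 3" "i \<noteq> l" for i l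
      using that ABC(1-3) unfolding X_def less3 by auto
    show "card (color_class H \<psi> i) \<le> card (X i)" if "i < 3" for i
      using that classes ABC(4-6) unfolding X_def less3 F_def by auto
  qed
  then obtain g' where g': "inj_on g' (verts H)" "\<And>v. v \<in> verts H \<Longrightarrow> g' v \<in> X (\<psi> v)"
    by blast
  have "has_monochromatic H (complete_graph n) c"
  proof (rule has_monochromatic_completeI[OF simple g'(1)])
    show "g' ` verts H \<subseteq> {..<n}"
      using g'(2) unfolding X_def by blast
    fix x y assume e: "{x, y} \<in> edges H"
    then have xy: "x \<in> verts H" "y \<in> verts H" "\<psi> x \<noteq> \<psi> y"
      using simple proper unfolding simple_graph_def proper_coloring_def by auto
    have "h (g' x) \<noteq> h (g' y)"
      using g'(2)[OF xy(1)] g'(2)[OF xy(2)] \<psi>[OF xy(1)] \<psi>[OF xy(2)] xy(3) ABC(1-3)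
      unfolding X_def less3 by auto
    moreover have "g' x < n" "g' y < n"
      using g'(2)[OF xy(1)] g'(2)[OF xy(2)] unfolding X_def by simp_all
    ultimately show "c {g' x, g' y} = q"
      using dom[of "g' x" "g' y"] by metis
  qed
  then show False
    using no_mono by blast
qed

lemma monochromatic_or_rainbow_P5:
  fixes c :: "nat set \<Rightarrow> nat"
  assumes arr: "arrows3 H n" and free: "\<not> has_rainbow (path_graph 5) (complete_graph n) c"
  shows "has_monochromatic H (complete_graph n) c"
proof -
  define d where "d x y = c {x, y}" for x y
  note free' = rainbow_P5_free_if_no_rainbow[OF free, folded d_def]
  have sym: "d x y = d y x" for x y
    unfolding d_def by (simp add: insert_commute)
  show ?thesis
  proof (cases "\<exists>p q r. c ` edges (complete_graph n) \<subseteq> {p, q, r}")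
    case True
    then show ?thesis
      using arrows3_three_colors[OF arr] by blast
  next
    case False
    then have four: "\<exists>x\<in>{..<n}. \<exists>y\<in>{..<n}. x \<noteq> y \<and> d x y \<notin> {p, q, r}" for p q r
      using fourth_color_edge[of c n p q r] unfolding d_def by blast
    show ?thesis
    proof (cases "\<exists>v x y z. {v, x, y, z} \<subseteq> {..<n} \<and> v \<notin> {x, y, z} \<and> distinct [d v x, d v y, d v z]")
      case False
      have "\<exists>q h. \<forall>x\<in>{..<n}. \<forall>y\<in>{..<n}. x \<noteq> y \<longrightarrow> d x y = q \<or> (d x y = h x \<and> d x y = h y)"
      proof (rule local_two_coloring_dominant[OF sym _ four])
        show "\<not> distinct [d v x, d v y, d v z]" if "{v, x, y, z} \<subseteq> {..<n}" "v \<notin> {x, y, z}" for v x y z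
          using False that by (simp only: not_ex de_Morgan_conj) meson
      qed
      then obtain q h where dom: "\<forall>x\<in>{..<n}. \<forall>y\<in>{..<n}. x \<noteq> y \<longrightarrow> d x y = q \<or> (d x y = h x \<and> d x y = h y)"
        by (elim exE) (rule that)
      show ?thesis
      proof (rule dominant_coloring_monochromatic[OF arr])
        show "c {x, y} = q \<or> (c {x, y} = h x \<and> c {x, y} = h y)" if "x < n" "y < n" "x \<noteq> y" for x y
          using dom[rule_format, of x y] that unfolding d_def by simp
      qed
    next
      case True
      then obtain v x y z where star: "{v, x, y, z} \<subseteq> {..<n}" "v \<notin> {x, y, z}"
        "distinct [d v x, d v y, d v z]"
        by (elim exE conjE) (rule that)
      then have dist: "distinct [v, x, y, z]"
        by auto
      obtain p q where pq: "p \<in> {..<n}" "q \<in> {..<n}" "p \<noteq> q" "d p q \<notin> {d v x, d v y, d v z}"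
        using four by blast
      obtain v x y z where paw: "{v, x, y, z} \<subseteq> {..<n}" "distinct [v, x, y, z]"
        "distinct [d v x, d v y, d v z, d x y]"
        using ex_rainbow_paw[OF free' sym star(1) dist star(3) pq] by (elim exE conjE) (rule that)
      define X where "X = {..<n} - {v, x, y, z}"
      have "card X = n - 4"
        using paw(1,2) unfolding X_def by (subst card_Diff_subset) auto
      \<comment> \<open>For at least five vertices, twice the order minus 1 is at least the order
        plus 4; for fewer, \<open>n\<close> being at least 9 suffices.\<close>
      moreover have "card (verts H) + 4 \<le> n"
        using arrows3_ge_9[OF simple not_bipartite arr]
          arrows3_ge_double[OF simple not_bipartite no_isolated arr] by linarith
      ultimately have X: "X \<subseteq> {..<n}" "card (verts H) \<le> card X"
        unfolding X_def by auto
      have z: "d u z = d u w" if "u \<in> X" "w \<in> X" "u \<noteq> w" for u w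
        using rainbow_paw_determines[OF free' sym _ _ paw(3), of u w] paw(1,2) that unfolding X_def by auto
      have "X \<noteq> {}"
        using X(2) card_verts gamma_pos by auto
      then obtain u\<^sub>0 where u0: "u\<^sub>0 \<in> X"
        by blast
      \<comment> \<open>By symmetry \<open>d u z\<close> and \<open>d u\<^sub>0 z\<close> both equal
        the colour of the edge joining \<open>u\<close> and \<open>u\<^sub>0\<close>, so one colour
        serves all of \<open>X\<close>.\<close>
      have "c {u, w} = d u\<^sub>0 z" if "u \<in> X" "w \<in> X" "u \<noteq> w" for u w
      proof -
        have "d u z = d u\<^sub>0 z"
          using z[of u u\<^sub>0] z[of u\<^sub>0 u] sym[of u u\<^sub>0] that(1) u0 by (cases "u = u\<^sub>0") auto
        then show ?thesis
          using z[OF that] unfolding d_def by simp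
      qed
      then show ?thesis
        by (rule monochromatic_clique_contains[OF simple X])
    qed
  qed
qed

text \<open>Both numbers are least elements of the same set of orders; conversely to the reduction,
  three colours cannot make four edges rainbow.\<close>

lemma constrained_ramsey_P5_eq_ramsey3: "constrained_ramsey H (path_graph 5) = ramsey3 H"
proof -
  have "arrows3 H n \<longleftrightarrow> (\<forall>c. has_monochromatic H (complete_graph n) c
      \<or> has_rainbow (path_graph 5) (complete_graph n) c)" for n
  proof (intro iffI allI)
    show "has_monochromatic H (complete_graph n) c \<or> has_rainbow (path_graph 5) (complete_graph n) c"
      if "arrows3 H n" for c
      using monochromatic_or_rainbow_P5[OF that] by blast
    show "arrows3 H n" if *: "\<forall>c. has_monochromatic H (complete_graph n) c
      \<or> has_rainbow (path_graph 5) (complete_graph n) c"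
      unfolding arrows3_def using * three_colors_no_rainbow_P5 by metis
  qed
  then show ?thesis
    unfolding constrained_ramsey_def ramsey3_def arrows3_def by simp
qed

end

section \<open>Disjoint unions\<close>

lemma chromatic_number_3_not_2_colorable:
  assumes "chromatic_number G = 3"
  shows "\<not> proper_coloring G 2 \<phi>"
proof
  assume "proper_coloring G 2 \<phi>"
  then have "chromatic_number G \<le> 2"
    unfolding chromatic_number_def by (intro Least_le) blast
  then show False
    using assms by simp
qed

lemma connected_graph_no_isolated:
  assumes conn: "connected_graph G" and two: "2 \<le> card (verts G)" and v: "v \<in> verts G"
  shows "\<exists>e\<in>edges G. v \<in> e"
proof -
  have "verts G \<noteq> {v}"
    using two by auto
  then obtain w where w: "w \<in> verts G" "w \<noteq> v"
    using v by blast
  then have "(v, w) \<in> {(x, y). {x, y} \<in> edges G}\<^sup>*"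
    using conn v unfolding connected_graph_def by blast
  then show ?thesis
    using w(2) by (cases rule: converse_rtranclE) auto
qed

lemma connected_graph_constant:
  assumes conn: "connected_graph G" and "u \<in> verts G" "v \<in> verts G"
    and const: "\<And>x y. {x, y} \<in> edges G \<Longrightarrow> f x = f y"
  shows "f u = f v"
proof -
  have "(u, v) \<in> {(x, y). {x, y} \<in> edges G}\<^sup>*"
    using assms unfolding connected_graph_def by blast
  then show ?thesis
    by induction (auto dest: const)
qed

lemma disjoint_union_edge_iff:
  "{(i, x), (j, y)} \<in> edges (disjoint_union_graph I G) \<longleftrightarrow> i \<in> I \<and> i = j \<and> {x, y} \<in> edges (G i)"
proof
  assume "{(i, x), (j, y)} \<in> edges (disjoint_union_graph I G)"
  then obtain k e where k: "k \<in> I" "e \<in> edges (G k)" "{(i, x), (j, y)} = Pair k ` e"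
    unfolding disjoint_union_graph_def by auto
  have "(i, x) \<in> Pair k ` e" "(j, y) \<in> Pair k ` e"
    using k(3) by blast+
  then have "i = k" "j = k"
    by auto
  \<comment> \<open>Projecting to second components recovers \<open>e\<close> from its tagged
    copy.\<close>
  moreover have "e = snd ` (Pair k ` e)"
    by (simp add: image_image)
  then have "e = {x, y}"
    unfolding k(3)[symmetric] by simp
  ultimately show "i \<in> I \<and> i = j \<and> {x, y} \<in> edges (G i)"
    using k by simp
next
  assume "i \<in> I \<and> i = j \<and> {x, y} \<in> edges (G i)"
  then show "{(i, x), (j, y)} \<in> edges (disjoint_union_graph I G)"
    unfolding disjoint_union_graph_def by (auto intro!: bexI[of _ i] image_eqI[of _ _ "{x, y}"])
qed

lemma verts_disjoint_union [simp]: "verts (disjoint_union_graph I G) = (SIGMA i:I. verts (G i))"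
  unfolding disjoint_union_graph_def by simp

lemma simple_graph_disjoint_union:
  assumes "finite I" "\<And>i. i \<in> I \<Longrightarrow> simple_graph (G i)"
  shows "simple_graph (disjoint_union_graph I G)"
  using assms unfolding simple_graph_def disjoint_union_graph_def
  by (auto simp: card_image inj_on_def)

lemma card_color_class_disjoint_union:
  assumes "finite I" "\<And>i. i \<in> I \<Longrightarrow> finite (verts (G i))"
  shows "card (color_class (disjoint_union_graph I G) (\<lambda>(i, v). \<phi> i v) k)
    = (\<Sum>i\<in>I. card (color_class (G i) (\<phi> i) k))"
proof -
  have "color_class (disjoint_union_graph I G) (\<lambda>(i, v). \<phi> i v) k
      = (SIGMA i:I. color_class (G i) (\<phi> i) k)"
    unfolding color_class_def by auto
  then show ?thesis
    using assms by (simp add: color_class_def)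
qed

lemma proper_coloring_disjoint_union:
  assumes "\<And>i. i \<in> I \<Longrightarrow> proper_coloring (G i) k (\<phi> i)"
  shows "proper_coloring (disjoint_union_graph I G) k (\<lambda>(i, v). \<phi> i v)"
  using assms unfolding proper_coloring_def by (auto simp: disjoint_union_edge_iff)

lemma proper_coloring_disjoint_union_component:
  assumes "proper_coloring (disjoint_union_graph I G) k \<psi>" "i \<in> I"
  shows "proper_coloring (G i) k (\<lambda>v. \<psi> (i, v))"
  using assms unfolding proper_coloring_def by (auto simp: disjoint_union_edge_iff)

theorem theorem1p12:
  fixes s t :: nat
    and G :: "nat \<Rightarrow> 'a ugraph"
    and a b c :: "nat \<Rightarrow> nat"
  assumes "1 \<le> s" and "s \<le> t"
    and "\<And>i. i \<in> {1..t} \<Longrightarrow> simple_graph (G i)"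
    and "\<And>i. i \<in> {1..t} \<Longrightarrow> connected_graph (G i)"
    and "\<And>i. i \<in> {1..s} \<Longrightarrow> chromatic_number (G i) = 3"
    and "\<And>i. i \<in> {s+1..t} \<Longrightarrow> bipartite_graph (G i)"
    and "\<And>i. i \<in> {1..t} \<Longrightarrow>
           \<exists>\<phi>. proper_coloring (G i) 3 \<phi> \<and>
             card (color_class (G i) \<phi> 0) = a i \<and>
             card (color_class (G i) \<phi> 1) = b i \<and>
             card (color_class (G i) \<phi> 2) = c i"
    and "\<And>i. i \<in> {1..t} \<Longrightarrow> a i \<ge> b i \<and> b i \<ge> c i \<and> c i = chromatic_surplus3 (G i)"
    and "\<And>i. i \<in> {1..s} \<Longrightarrow> a i - b i \<le> 1"
    and "\<And>i. i \<in> {s+1..t} \<Longrightarrow> a i = b i"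
    and "\<And>i. i \<in> {1..t} \<Longrightarrow> b i + c i \<ge> (\<Sum>j\<in>{1..t} - {i}. c j)"
  shows "constrained_ramsey (disjoint_union_graph {1..t} G) (path_graph 5)
       = ramsey3 (disjoint_union_graph {1..t} G)"
proof -
  define I where "I = {1..t}"
  define H where "H = disjoint_union_graph I G"
  have simple: "simple_graph (G i)" and conn: "connected_graph (G i)"
    and abc: "c i \<le> b i" "b i \<le> a i" and ii: "(\<Sum>j\<in>I - {i}. c j) \<le> b i + c i" if "i \<in> I" for i
    using assms(3,4,8,11)[of i] that unfolding I_def by auto
  have split: "i \<in> {1..s} \<or> i \<in> {s+1..t}" if "i \<in> I" for i
    using that unfolding I_def by auto
  obtain \<phi> where \<phi>: "proper_coloring (G i) 3 (\<phi> i)" and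
    classes: "card (color_class (G i) (\<phi> i) 0) = a i" "card (color_class (G i) (\<phi> i) 1) = b i"
      "card (color_class (G i) (\<phi> i) 2) = c i" if "i \<in> I" for i
    using assms(7) unfolding I_def by metis
  have card_G: "card (verts (G i)) = a i + b i + c i" if "i \<in> I" for i
    using card_verts_eq_color_classes[OF simple[OF that] \<phi>[OF that]] classes[OF that] by simp
  have c_pos: "0 < c i" if "i \<in> {1..s}" for i
  proof -
    have i: "i \<in> I"
      using that assms(2) unfolding I_def by auto
    show ?thesis
      using third_class_pos[OF simple[OF i] \<phi>[OF i]] classes(3)[OF i]
        chromatic_number_3_not_2_colorable[OF assms(5)[OF that]] by simp
  qed
  \<comment> \<open>For 3-chromatic components (i) gives \<open>a i - b i \<le> 1 \<le> c i\<close>;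
    for the others \<open>a i = b i\<close>.\<close>
  have a_le: "a i \<le> b i + c i" if "i \<in> I" for i
    using split[OF that] assms(9,10)[of i] c_pos[of i] by fastforce
  have two: "2 \<le> card (verts (G i))" if "i \<in> I" for i
  proof -
    have "finite (verts (G i))" "verts (G i) \<noteq> {}"
      using simple[OF that] conn[OF that] unfolding simple_graph_def connected_graph_def by auto
    then have "0 < card (verts (G i))"
      by (simp add: card_gt_0_iff)
    \<comment> \<open>The first class is the largest, so it is nonempty; then
      \<open>b i + c i\<close> is positive too, which rules out single-vertex components.\<close>
    then have "1 \<le> a i"
      using card_G[OF that] abc[OF that] by linarith
    then show ?thesis
      using card_G[OF that] a_le[OF that] by linarith
  qed
  have "1 \<in> I"
    using assms(1,2) unfolding I_def by simp
  interpret balanced_3_chromatic H "\<lambda>(i, v). \<phi> i v" "sum a I" "sum b I" "sum c I"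
  proof
    show "simple_graph H"
      unfolding H_def using simple by (intro simple_graph_disjoint_union) (simp_all add: I_def)
    show "\<not> bipartite_graph H"
      using proper_coloring_disjoint_union_component[OF _ \<open>1 \<in> I\<close>, of G 2]
        chromatic_number_3_not_2_colorable[of "G 1"] assms(1) assms(5)[of 1]
      unfolding bipartite_graph_def H_def by fastforce
    show "\<exists>e\<in>edges H. v \<in> e" if v: "v \<in> verts H" for v
    proof -
      obtain i x where x: "v = (i, x)" "i \<in> I" "x \<in> verts (G i)"
        using v unfolding H_def by auto
      then obtain e where "e \<in> edges (G i)" "x \<in> e"
        using connected_graph_no_isolated[OF conn two] by blast
      then show ?thesis
        using x unfolding H_def disjoint_union_graph_def by auto
    qed
    show "proper_coloring H 3 (\<lambda>(i, v). \<phi> i v)"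
      unfolding H_def using \<phi> by (rule proper_coloring_disjoint_union)
    have fin: "finite I" "\<And>i. i \<in> I \<Longrightarrow> finite (verts (G i))"
      using simple unfolding I_def simple_graph_def by auto
    have card_class: "card (color_class H (\<lambda>(i, v). \<phi> i v) k)
        = (\<Sum>i\<in>I. card (color_class (G i) (\<phi> i) k))" for k
      unfolding H_def using fin by (rule card_color_class_disjoint_union)
    show "card (color_class H (\<lambda>(i, v). \<phi> i v) 0) = sum a I"
      "card (color_class H (\<lambda>(i, v). \<phi> i v) 1) = sum b I"
      "card (color_class H (\<lambda>(i, v). \<phi> i v) 2) = sum c I"
      unfolding card_class using classes by simp_all
    show "sum c I \<le> sum b I" "sum b I \<le> sum a I"
      using abc by (auto intro: sum_mono)
    show "sum a I \<le> sum b I + sum c I"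
      using a_le by (simp add: sum.distrib[symmetric] sum_mono)
    fix f :: "nat \<times> 'a \<Rightarrow> nat" and v
    assume v: "v \<in> verts H" and f: "\<And>e x y. e \<in> edges H \<Longrightarrow> x \<in> e \<Longrightarrow> y \<in> e \<Longrightarrow> f x = f y"
    obtain i x where x: "v = (i, x)" "i \<in> I" "x \<in> verts (G i)"
      using v unfolding H_def by auto
    have const: "f (i, y) = f (i, z)" if "{y, z} \<in> edges (G i)" for y z
      using f[of "{(i, y), (i, z)}"] that x(2) unfolding H_def disjoint_union_edge_iff by blast
    have "f (i, y) = f v" if "y \<in> verts (G i)" for y
      using connected_graph_constant[OF conn[OF x(2)] that x(3), of "\<lambda>y. f (i, y)"] const x(1) by blast
    then have sub: "Pair i ` verts (G i) \<subseteq> {w \<in> verts H. f w = f v}"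
      using x(2) unfolding H_def by auto
    \<comment> \<open>By (ii) the sum over the other components is at most \<open>b i + c i\<close>,
      and the extra \<open>c i\<close> is at most \<open>a i\<close>; so component \<open>i\<close>
      alone has \<gamma> vertices.\<close>
    have "sum c I = c i + (\<Sum>j\<in>I - {i}. c j)"
      using fin(1) x(2) by (rule sum.remove)
    also have "\<dots> \<le> card (verts (G i))"
      using ii[OF x(2)] abc[OF x(2)] card_G[OF x(2)] by linarith
    also have "\<dots> = card (Pair i ` verts (G i))"
      by (simp add: card_image inj_on_def)
    also have "\<dots> \<le> card {w \<in> verts H. f w = f v}"
      using sub fin unfolding H_def by (intro card_mono) auto
    finally show "sum c I \<le> card {w \<in> verts H. f w = f v}" .
  qed
  show ?thesis
    using constrained_ramsey_P5_eq_ramsey3 unfolding H_def I_def .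
qed

end
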